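(* Let $t_n$ denote the Fine numbers and $C_n$ the Catalan numbers, let $D_{\pm}(a_1,\ldots,a_n)$ denote the $n\times n$ Hessenberg--Toeplitz determinant with superdiagonal entries $\pm1$, and let $A137398[n]$ ($n\ge1$) and $A030238[n]$ ($n\ge0$) be the integer sequences defined in the context. Let $(u_n)_{n\ge1}$ be the sequence defined by $u_1=u_2=1$ and $$u_n=u_{n-1}+\sum_{i=1}^{n-2}(-1)^{i+1}C_iu_{n-i-1},\qquad n\ge3.$$ Then the following formulas hold for all $n\ge1$, unless stated otherwise: \begin{align*} D_+(t_1,t_2,\ldots,t_n)&=u_n,\\ D_-(t_1,t_2,\ldots,t_n)&=C_{n-1},\\ D_+(t_2,t_3,\ldots,t_{n+1})&=(-1)^{n-1}C_{n-1}\quad(n\ge2),\\ D_-(t_2,t_3,\ldots,t_{n+1})&=A137398[n],\\ D_+(t_3,t_4,\ldots,t_{n+2})&=(-1)^{n-1}A030238[n-1],\\ D_+(t_4,t_5,\ldots,t_{n+3})&=(-1)^{n-1}C_{n-1}\quad(n\ge3). \end{align*}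
   Context: Fine numbers: $t_0=0$ and $t_n=3\sum_{k=1}^{\lfloor (n+1)/2\rfloor}\binom{2n-2k}{n-1}-\binom{2n}{n}$ for $n\ge1$, so $(t_n)_{n\ge0}=0,1,0,1,2,6,18,57,186,\ldots$. Catalan numbers: $C_n=\frac1{n+1}\binom{2n}n$ for $n\ge0$. Determinants: for $a_0\in\{1,-1\}$ and numbers $a_1,\ldots,a_n$, let $A_n(a_0;a_1,\ldots,a_n)$ be the $n\times n$ matrix whose $(i,j)$ entry is $a_{i-j+1}$ if $j\le i$, $a_0$ if $j=i+1$, and $0$ if $j>i+1$. Put $D_{+}(a_1,\ldots,a_n)=\det A_n(1;a_1,\ldots,a_n)$ and $D_{-}(a_1,\ldots,a_n)=\det A_n(-1;a_1,\ldots,a_n)$. OEIS sequences: $A137398[n]=b_n$ for $n\ge1$, where $b_1=0$, $b_2=1$, $b_3=2$ and $b_n=2b_{n-1}+2b_{n-2}+\sum_{k=1}^{n-3}C_kb_{n-k-1}$ for $n\ge4$. For $n\ge0$, $A030238[n]=\sum_{j=1}^{\lfloor (n+2)/2\rfloor}a(n+2-j,j)$, where $a(m,j)$ is the number of Dyck paths from $(0,0)$ to $(2m,0)$ (steps $u=(1,1)$ and $d=(1,-1)$, never going below the $x$-axis) having exactly $j$ returns, i.e., exactly $j$ steps $d$ that end on the $x$-axis (including the final step). *)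

theory Defs
  imports "Jordan_Normal_Form.Determinant"
begin

definition fine :: "nat \<Rightarrow> int" where
  "fine n = (if n = 0 then 0
     else 3 * (\<Sum>k = 1..(n + 1) div 2. int ((2 * n - 2 * k) choose (n - 1)))
            - int ((2 * n) choose n))"

text \<open>The integer division is exact, as shown by the lemma below.\<close>

definition catalan :: "nat \<Rightarrow> int" where
  "catalan n = int ((2 * n) choose n) div int (n + 1)"

lemma catalan_exact: "int (n + 1) * catalan n = int ((2 * n) choose n)"
proof -
  have "n * ((2 * n) choose n) = (n + 1) * ((2 * n) choose (n + 1))"
    using binomial_absorb_comp[of "2 * n" n] binomial_absorption[of n "2 * n"]
    by simp
  then have "(n + 1) dvd n * ((2 * n) choose n)"
    by (rule dvdI)
  moreover have "coprime (n + 1) n"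
    by simp
  ultimately have "(n + 1) dvd ((2 * n) choose n)"
    using coprime_dvd_mult_right_iff by blast
  then have "int (n + 1) dvd int ((2 * n) choose n)"
    by (simp only: of_nat_dvd_iff)
  then show ?thesis
    unfolding catalan_def by (rule dvd_mult_div_cancel)
qed

text \<open>
  The list \<open>as\<close> holds $a_1, \ldots, a_n$, so that \<open>as ! k\<close> is $a_{k+1}$, and \<open>i\<close>, \<open>j\<close> count
  rows and columns from 0. Entries depend only on $i - j$: on and below the diagonal the entry
  $a_{i-j+1}$ is \<open>as ! (i - j)\<close>.
\<close>

definition hess_toeplitz :: "'a :: comm_ring_1 \<Rightarrow> 'a list \<Rightarrow> 'a mat" where
  "hess_toeplitz a0 as = mat (length as) (length as)
     (\<lambda>(i, j). if j \<le> i then as ! (i - j) else if j = i + 1 then a0 else 0)"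

definition D_plus :: "'a :: comm_ring_1 list \<Rightarrow> 'a" where
  "D_plus as = det (hess_toeplitz 1 as)"

definition D_minus :: "'a :: comm_ring_1 list \<Rightarrow> 'a" where
  "D_minus as = det (hess_toeplitz (- 1) as)"

text \<open>The sequence starts at index 1; the value at 0 is a dummy that the recurrence never uses.\<close>

fun A137398 :: "nat \<Rightarrow> int" where
  "A137398 n =
    (if n \<le> 1 then 0 else if n = 2 then 1 else if n = 3 then 2
     else 2 * A137398 (n - 1) + 2 * A137398 (n - 2)
          + (\<Sum>k = 1..n - 3. catalan k * A137398 (n - k - 1)))"

declare A137398.simps [simp del]

text \<open>
  A path is the list of the vertical components of its steps, 1 for $u$ and -1 for $d$; its height
  after \<open>k\<close> steps is \<open>sum_list (take k w)\<close>.
\<close>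

definition dyck_paths :: "nat \<Rightarrow> int list set" where
  "dyck_paths m = {w. length w = 2 * m \<and> set w \<subseteq> {1, - 1} \<and>
     (\<forall>k \<le> 2 * m. 0 \<le> sum_list (take k w)) \<and> sum_list w = 0}"

lemma finite_dyck_paths: "finite (dyck_paths m)"
proof (rule finite_subset)
  show "dyck_paths m \<subseteq> {w. set w \<subseteq> {1, - 1} \<and> length w = 2 * m}"
    by (auto simp: dyck_paths_def)
  show "finite {w :: int list. set w \<subseteq> {1, - 1} \<and> length w = 2 * m}"
    by (rule finite_lists_length_eq) simp
qed

definition returns :: "int list \<Rightarrow> nat" where
  "returns w = card {k. k < length w \<and> w ! k = - 1 \<and> sum_list (take (Suc k) w) = 0}"

definition dyck_returns :: "nat \<Rightarrow> nat \<Rightarrow> nat" where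
  "dyck_returns m j = card {w \<in> dyck_paths m. returns w = j}"

definition A030238 :: "nat \<Rightarrow> nat" where
  "A030238 n = (\<Sum>j = 1..(n + 2) div 2. dyck_returns (n + 2 - j) j)"

end

theory Submission
  imports Defs "HOL-Computational_Algebra.Formal_Power_Series"
begin

text \<open>
  Expanding along the first row gives a convolution recurrence for the determinants: if $E(x)$
  generates $(\mp 1)^n D_\pm(a_1, \ldots, a_n)$ and $a(x) = \sum_{i \ge 1} a_i x^i$, then
  $E (1 \pm a) = 1$. Everything is then expressed in $P = x C(x)$, where $C$ generates the
  Catalan numbers: $x = P - P^2$ and the Fine numbers have generating function $T$ with
  $T (1 + P) = P$, so that every $E$ is a rational function of $P$. For A030238, walks are counted
  from an arbitrary starting height by removing the first step; Dyck paths of semilength $m$ with $j$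
  returns are then counted by $[x^m] P^j$.
\<close>

section \<open>Hessenberg--Toeplitz determinants\<close>

text \<open>The first column is free: deleting row 0 and column 1 shifts that column by one entry
  and leaves the rest Toeplitz, so the first-row expansion stays in the family.\<close>

definition hess_mat :: "'a :: comm_ring_1 \<Rightarrow> (nat \<Rightarrow> 'a) \<Rightarrow> (nat \<Rightarrow> 'a) \<Rightarrow> nat \<Rightarrow> 'a mat" where
  "hess_mat e v a n = mat n n (\<lambda>(i, j).
     if j = 0 then v i else if j \<le> i then a (i - j) else if j = i + 1 then e else 0)"

lemma det_hess_mat_Suc:
  "det (hess_mat e v a (Suc n)) =
     v 0 * det (hess_mat e a a n)
     - (if n = 0 then 0 else e * det (hess_mat e (\<lambda>i. v (Suc i)) a n))"
proof -
  let ?A = "hess_mat e v a (Suc n)"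
  have A: "?A \<in> carrier_mat (Suc n) (Suc n)"
    by (simp add: hess_mat_def)
  have del0: "mat_delete ?A 0 0 = hess_mat e a a n"
    by (rule eq_matI) (auto simp: mat_delete_def hess_mat_def)
  have exp: "det ?A = (\<Sum>j<Suc n. ?A $$ (0, j) * cofactor ?A 0 j)"
    by (rule laplace_expansion_row[OF A]) simp
  show ?thesis
  proof (cases n)
    case 0
    then show ?thesis
      unfolding exp using del0 by (simp add: cofactor_def) (simp add: hess_mat_def)
  next
    case (Suc m)
    have del1: "mat_delete ?A 0 1 = hess_mat e (\<lambda>i. v (Suc i)) a n"
      by (rule eq_matI) (auto simp: mat_delete_def hess_mat_def)
    have "(\<Sum>j<Suc n. ?A $$ (0, j) * cofactor ?A 0 j) =
        (\<Sum>j\<in>{0, 1}. ?A $$ (0, j) * cofactor ?A 0 j)"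
      by (rule sum.mono_neutral_right) (auto simp: Suc hess_mat_def)
    then have "det ?A = ?A $$ (0, 0) * cofactor ?A 0 0 + ?A $$ (0, 1) * cofactor ?A 0 1"
      unfolding exp by simp
    moreover have "?A $$ (0, 0) = v 0" "?A $$ (0, 1) = e"
      by (auto simp: Suc hess_mat_def)
    ultimately show ?thesis
      unfolding cofactor_def del0 del1 by (simp add: Suc)
  qed
qed

text \<open>Each expansion step shifts \<open>v\<close> by one entry and contributes a factor
  \<open>- e\<close>, hence the induction over all \<open>v\<close>.\<close>

lemma det_hess_mat:
  "n > 0 \<Longrightarrow> det (hess_mat e v a n) =
     (\<Sum>i<n. (- e) ^ i * v i * det (hess_mat e a a (n - 1 - i)))"
proof (induction n arbitrary: v)
  case (Suc n)
  show ?case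
    by (cases "n = 0")
      (simp_all add: det_hess_mat_Suc[of e v] Suc.IH sum.lessThan_Suc_shift sum_distrib_left
        sum_negf mult.assoc del: sum.lessThan_Suc)
qed simp

lemma hess_toeplitz_eq:
  "hess_toeplitz e (map f [s..<n + s]) = hess_mat e (\<lambda>i. f (i + s)) (\<lambda>i. f (i + s)) n"
  by (rule eq_matI) (auto simp: hess_toeplitz_def hess_mat_def add.commute)

text \<open>
  The factor \<open>(- e) ^ n\<close> absorbs the signs of the cofactors, so that the only sign left in the
  recurrence is a global factor \<open>e\<close>.
\<close>

definition det_fps :: "'a :: comm_ring_1 \<Rightarrow> (nat \<Rightarrow> 'a) \<Rightarrow> nat \<Rightarrow> 'a fps" where
  "det_fps e f s = Abs_fps (\<lambda>n. (- e) ^ n * det (hess_toeplitz e (map f [s..<n + s])))"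

lemma det_fps_eq:
  fixes e :: "'a :: comm_ring_1"
  assumes "e * e = 1"
  shows "det_fps e f s = 1 - fps_const e * fps_X * Abs_fps (\<lambda>i. f (i + s)) * det_fps e f s"
proof (rule fps_ext)
  fix n
  define a where "a = (\<lambda>i. f (i + s))"
  define d where "d n = det (hess_mat e a a n)" for n
  have nth: "fps_nth (det_fps e f s) n = (- e) ^ n * d n" for n
    unfolding det_fps_def hess_toeplitz_eq d_def a_def by simp
  have d0: "d 0 = 1"
    by (simp add: d_def hess_mat_def)
  show "fps_nth (det_fps e f s) n =
      fps_nth (1 - fps_const e * fps_X * Abs_fps (\<lambda>i. f (i + s)) * det_fps e f s) n"
  proof (cases n)
    case 0
    then show ?thesis by (simp add: nth d0)
  next
    case (Suc m)
    \<comment> \<open>The exponents \<open>Suc m + i\<close> and \<open>1 + (m - i)\<close> differ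
      by \<open>2 * i\<close>.\<close>
    have pow: "x ^ Suc m * x ^ i = x * x ^ (m - i)" if "i \<le> m" "x * x = 1" for i and x :: 'a
    proof -
      have "x ^ Suc m * x ^ i = x * x ^ (m - i) * (x * x) ^ i"
        using that(1) by (simp add: power_mult_distrib power_add[symmetric] mult.assoc)
      then show ?thesis using that(2) by simp
    qed
    have sgn: "(- e) ^ Suc m * (- e) ^ i = - e * (- e) ^ (m - i)" if "i \<le> m" for i
      using pow[OF that, of "- e"] assms by simp
    have "fps_nth (det_fps e f s) n =
        (\<Sum>i\<le>m. ((- e) ^ Suc m * (- e) ^ i) * (a i * d (m - i)))"
      unfolding nth Suc d_def
      by (subst det_hess_mat) (simp_all add: sum_distrib_left lessThan_Suc_atMost mult.assoc)
    also have "\<dots> = (\<Sum>i\<le>m. - e * (a i * ((- e) ^ (m - i) * d (m - i))))"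
      by (intro sum.cong refl, subst sgn) (simp, simp only: mult_ac)
    also have "\<dots> = - e * fps_nth (Abs_fps a * det_fps e f s) m"
      by (simp add: fps_mult_nth nth atMost_atLeast0 sum_distrib_left sum_negf)
    finally show ?thesis
      by (simp add: Suc a_def mult.assoc)
  qed
qed

section \<open>The Catalan and Fine generating functions\<close>

definition C_fps :: "int fps" where
  "C_fps = Abs_fps catalan"

definition P_fps :: "int fps" where
  "P_fps = fps_X * C_fps"

definition T_fps :: "int fps" where
  "T_fps = Abs_fps fine"

definition central_fps :: "nat \<Rightarrow> int fps" where
  "central_fps j = Abs_fps (\<lambda>m. int ((2 * m + j) choose m))"

text \<open>Goes through \<open>(2 * n + 1) choose n\<close>; each of the two comparisons carries a
  factor \<open>n + 1\<close>, which is cancelled.\<close>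

lemma central_binomial_Suc:
  "int ((2 * Suc n) choose Suc n) = 2 * int (2 * n + 1) * catalan n"
proof -
  have "int (n + 1) * int ((2 * Suc n) choose Suc n) = int (n + 1) * (2 * int ((2 * n + 1) choose n))"
    using Suc_times_binomial[of n "2 * n + 1"]
    by (simp add: algebra_simps del: binomial_Suc_Suc flip: of_nat_mult)
  then have 1: "int ((2 * Suc n) choose Suc n) = 2 * int ((2 * n + 1) choose n)"
    by (subst (asm) mult_cancel_left) simp
  have "(n + 1) * ((2 * n + 1) choose n) = (2 * n + 1) * ((2 * n) choose n)"
    using Suc_times_binomial[of n "2 * n"] binomial_symmetric[of n "2 * n + 1"] by simp
  then have "int (n + 1) * int ((2 * n + 1) choose n) = int (2 * n + 1) * int ((2 * n) choose n)"
    by (metis of_nat_mult)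
  also have "\<dots> = int (n + 1) * (int (2 * n + 1) * catalan n)"
    unfolding catalan_exact[symmetric] by (rule mult.left_commute)
  finally have "int ((2 * n + 1) choose n) = int (2 * n + 1) * catalan n"
    by (subst (asm) mult_cancel_left) simp
  with 1 show ?thesis by simp
qed

lemma catalan_0 [simp]: "catalan 0 = 1"
  by (simp add: catalan_def)

lemma deriv_P_fps: "fps_deriv P_fps = central_fps 0"
proof (rule fps_ext)
  fix n
  show "fps_nth (fps_deriv P_fps) n = fps_nth (central_fps 0) n"
    using catalan_exact[of n] by (simp add: P_fps_def C_fps_def central_fps_def algebra_simps)
qed

text \<open>At index \<open>m + 1\<close> this is
  \<open>2 (2m + 1) C_m - 4 (m + 1) C_m = - 2 C_m\<close>.\<close>

lemma central_fps_0_ode: "(1 - 4 * fps_X) * central_fps 0 = 1 - 2 * P_fps"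
proof (rule fps_ext)
  fix n
  show "fps_nth ((1 - 4 * fps_X) * central_fps 0) n = fps_nth (1 - 2 * P_fps) n"
    using central_binomial_Suc[of "n - 1"] catalan_exact[of "n - 1"]
    by (cases n) (simp_all add: P_fps_def C_fps_def central_fps_def left_diff_distrib
        numeral_fps_const mult.assoc algebra_simps del: binomial_Suc_Suc)
qed

text \<open>
  Writing $S = 1 - 2P$, the two previous lemmas give $(1 - 4x) S' = - 2 S$, so $Q = S^2$ satisfies
  $(1 - 4x) Q' = - 4 Q$, which determines $Q$ from $Q(0) = 1$.
\<close>

lemma P_fps_sqrt: "(1 - 2 * P_fps) ^ 2 = 1 - 4 * fps_X"
proof -
  define Q where "Q = (1 - 2 * P_fps) ^ 2"
  have "(1 - 4 * fps_X) * fps_deriv Q =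
      - 4 * (1 - 2 * P_fps) * ((1 - 4 * fps_X) * central_fps 0)"
    by (simp add: Q_def power2_eq_square deriv_P_fps algebra_simps)
  then have ode: "(1 - 4 * fps_X) * fps_deriv Q = - 4 * Q"
    by (simp only: central_fps_0_ode Q_def power2_eq_square mult.assoc)
  have rec: "int (Suc n) * fps_nth Q (Suc n) = 4 * (int n - 1) * fps_nth Q n" for n
    using arg_cong[OF ode, of "\<lambda>f. fps_nth f n"]
    by (cases n) (simp_all add: left_diff_distrib fps_numeral_fps_const mult.assoc algebra_simps)
  have Q0: "fps_nth Q 0 = 1"
    by (simp add: Q_def P_fps_def power2_eq_square)
  have Q1: "fps_nth Q 1 = - 4"
    using rec[of 0] Q0 by simp
  \<comment> \<open>The factor \<open>n - 1\<close> in \<open>rec\<close> kills the coefficient of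
    index 2, and the recurrence propagates the zero.\<close>
  have Q2: "fps_nth Q (n + 2) = 0" for n
  proof (induction n)
    case 0
    show ?case using rec[of 1] by (simp add: numeral_2_eq_2)
  next
    case (Suc n)
    then show ?case using rec[of "n + 2"] by simp
  qed
  have "fps_nth Q n = fps_nth (1 - 4 * fps_X) n" for n
  proof (cases "n < 2")
    case True
    then show ?thesis using Q0 Q1 by (auto simp: less_2_cases_iff fps_numeral_fps_const)
  next
    case False
    then obtain m where "n = m + 2"
      by (metis add.commute le_Suc_ex not_less)
    then show ?thesis using Q2[of m] by (simp add: fps_numeral_fps_const fps_X_def)
  qed
  then show ?thesis unfolding Q_def[symmetric] by (rule fps_ext)
qed

lemma P_fps_quadratic: "P_fps\<^sup>2 = P_fps - fps_X"
proof -
  have "4 * P_fps\<^sup>2 = 4 * (P_fps - fps_X)"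
    using P_fps_sqrt by (simp add: power2_eq_square algebra_simps)
  then show ?thesis by (simp only: mult_cancel_left) simp
qed

lemma C_fps_eq: "C_fps = 1 + fps_X * C_fps\<^sup>2"
proof -
  have "fps_X * C_fps = fps_X * (1 + fps_X * C_fps\<^sup>2)"
    using P_fps_quadratic by (simp add: P_fps_def power2_eq_square algebra_simps)
  then show ?thesis by (simp only: mult_cancel_left) simp
qed

text \<open>One further factor \<open>1 - 2P\<close> turns this into
  \<open>central_fps_0_ode\<close>, since \<open>(1 - 2P)^2 = 1 - 4x\<close>.\<close>

lemma central_fps_0_mult: "(1 - 2 * P_fps) * central_fps 0 = 1"
proof -
  have "(1 - 2 * P_fps) * ((1 - 2 * P_fps) * central_fps 0) = (1 - 2 * P_fps) * 1"
    using P_fps_sqrt central_fps_0_ode by (simp add: power2_eq_square mult.assoc[symmetric])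
  moreover have "fps_nth (1 - 2 * P_fps) 0 \<noteq> 0"
    by (simp add: P_fps_def)
  then have "1 - 2 * P_fps \<noteq> 0" by fastforce
  ultimately show ?thesis by (simp only: mult_cancel_left) simp
qed

section \<open>Series of binomials at a fixed distance from the centre\<close>

lemma central_fps_rec: "central_fps (Suc j) = central_fps j + fps_X * central_fps (Suc (Suc j))"
proof (rule fps_ext)
  fix n
  show "fps_nth (central_fps (Suc j)) n =
      fps_nth (central_fps j + fps_X * central_fps (Suc (Suc j))) n"
    by (cases n) (simp_all add: central_fps_def)
qed

lemma central_fps_1: "central_fps 0 = 1 + 2 * fps_X * central_fps 1"
proof (rule fps_ext)
  fix n
  show "fps_nth (central_fps 0) n = fps_nth (1 + 2 * fps_X * central_fps 1) n"
  proof (cases n)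
    case (Suc m)
    have "(2 * m + 1) choose m = (2 * m + 1) choose Suc m"
      by (subst binomial_symmetric) auto
    then show ?thesis
      by (simp add: Suc central_fps_def numeral_fps_const mult.assoc)
  qed (simp add: central_fps_def)
qed

text \<open>By \<open>x C^2 = C - 1\<close>, the right-hand side satisfies the recurrence
  \<open>central_fps_rec\<close>. For \<open>j = 1\<close>, \<open>central_fps_1\<close> and
  \<open>central_fps_0_mult\<close> give two expressions for
  \<open>central_fps 0 - 1\<close>.\<close>

lemma central_fps_eq: "central_fps j = C_fps ^ j * central_fps 0"
proof (induction j rule: induct_nat_012)
  case 1
  have "2 * fps_X * central_fps 1 - 2 * fps_X * (C_fps * central_fps 0) =
      (1 - 2 * P_fps) * central_fps 0 - (central_fps 0 - 2 * fps_X * central_fps 1)"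
    by (simp add: P_fps_def algebra_simps)
  also have "\<dots> = 0"
    unfolding central_fps_0_mult by (simp add: central_fps_1)
  finally have "2 * fps_X * central_fps 1 = 2 * fps_X * (C_fps * central_fps 0)"
    by simp
  then have "central_fps 1 = C_fps * central_fps 0"
    by (simp only: mult_cancel_left) simp
  then show ?case by simp
next
  case (ge2 j)
  have "fps_X * central_fps (Suc (Suc j)) = (C_fps - 1) * (C_fps ^ j * central_fps 0)"
    using central_fps_rec[of j] ge2 by (simp add: algebra_simps)
  also have "\<dots> = fps_X * (C_fps ^ Suc (Suc j) * central_fps 0)"
  proof -
    have "C_fps - 1 = fps_X * C_fps\<^sup>2"
      using C_fps_eq by (metis add_diff_cancel_left')
    then show ?thesis by (simp add: power2_eq_square mult_ac)
  qed
  finally show ?case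
    by (simp only: mult_cancel_left) simp
qed simp

section \<open>Generating function of the Fine numbers\<close>

definition fine_sum_fps :: "int fps" where
  "fine_sum_fps = Abs_fps (\<lambda>n. \<Sum>k = 1..(n + 1) div 2. int ((2 * n - 2 * k) choose (n - 1)))"

text \<open>
  Since $\binom{2n-2k}{n-1} = \binom{2m+2k-2}{m}$ with $m = n-2k+1$, the $k$-th summand
  contributes $x^{2k-1} C^{2k-2} B$ with $B$ the central binomial series: a geometric series of
  ratio $P^2$.
\<close>

lemma fine_sum_fps_nth:
  assumes "n \<le> N"
  shows "fps_nth fine_sum_fps n =
    fps_nth (fps_X * central_fps 0 * (\<Sum>k<Suc N. (P_fps\<^sup>2) ^ k)) n"
proof -
  \<comment> \<open>The guard says \<open>2k + 1 \<le> n\<close>; beyond it the factor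
    \<open>x^(2k+1)\<close> makes the coefficient vanish.\<close>
  have coeff: "fps_nth (fps_X * central_fps 0 * (P_fps\<^sup>2) ^ k) n =
      (if 2 * Suc k \<le> n + 1 then int ((2 * n - 2 * Suc k) choose (n - 1)) else 0)" for k
  proof -
    have "fps_X * central_fps 0 * (P_fps\<^sup>2) ^ k = fps_X ^ (2 * k + 1) * central_fps (2 * k)"
      unfolding central_fps_eq[of "2 * k"]
      by (simp add: P_fps_def power_mult_distrib power_mult[symmetric] mult_ac)
    moreover have "(2 * (n - (2 * k + 1)) + 2 * k) choose (n - (2 * k + 1)) =
        (2 * n - 2 * Suc k) choose (n - 1)" if "2 * Suc k \<le> n + 1"
      using that by (subst binomial_symmetric) (auto intro!: arg_cong2[of _ _ _ _ "(choose)"])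
    ultimately show ?thesis
      by (simp add: fps_X_power_mult_nth central_fps_def del: power_Suc)
  qed
  have "fps_nth fine_sum_fps n =
      (\<Sum>k = 1..(n + 1) div 2. int ((2 * n - 2 * k) choose (n - 1)))"
    by (simp add: fine_sum_fps_def)
  also have "\<dots> = (\<Sum>k<(n + 1) div 2. int ((2 * n - 2 * Suc k) choose (n - 1)))"
    by (rule sum.reindex_bij_witness[of _ Suc "\<lambda>k. k - 1"]) auto
  also have "\<dots> = (\<Sum>k<Suc N. fps_nth (fps_X * central_fps 0 * (P_fps\<^sup>2) ^ k) n)"
    using assms by (intro sum.mono_neutral_cong_left) (auto simp: coeff)
  finally show ?thesis
    by (simp add: sum_distrib_left fps_sum_nth del: sum.lessThan_Suc)
qed

text \<open>The partial sum of \<open>Suc n\<close> terms is exact in all coefficients up to index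
  \<open>n\<close>, and its remainder contains \<open>P^(2n+2)\<close>, hence a multiple of
  \<open>x^(n+1)\<close>.\<close>

lemma fine_sum_fps_mult: "fine_sum_fps * (1 - P_fps\<^sup>2) = fps_X * central_fps 0"
proof (rule fps_ext)
  fix n
  let ?R = "fps_X * central_fps 0 * (\<Sum>k<Suc n. (P_fps\<^sup>2) ^ k)"
  have "fps_nth (fine_sum_fps * (1 - P_fps\<^sup>2)) n = fps_nth (?R * (1 - P_fps\<^sup>2)) n"
    unfolding fps_mult_nth[of fine_sum_fps] fps_mult_nth[of ?R]
    using fine_sum_fps_nth[of _ n] by (intro sum.cong refl) (simp del: sum.lessThan_Suc)
  also have "?R * (1 - P_fps\<^sup>2) = fps_X * central_fps 0 * (1 - (P_fps\<^sup>2) ^ Suc n)"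
    unfolding one_diff_power_eq[of "P_fps\<^sup>2" "Suc n"] by (simp only: mult_ac)
  also have "\<dots> = fps_X * central_fps 0
      - fps_X ^ Suc n * (fps_X ^ Suc n * C_fps ^ (2 * Suc n) * fps_X * central_fps 0)"
    by (simp add: P_fps_def power_mult_distrib power_mult[symmetric] power_add[symmetric]
        algebra_simps mult_2)
  finally show "fps_nth (fine_sum_fps * (1 - P_fps\<^sup>2)) n = fps_nth (fps_X * central_fps 0) n"
    by (simp only: fps_sub_nth fps_X_power_mult_nth) simp
qed

text \<open>With \<open>central_fps 0 = 1/(1 - 2P)\<close> and
  \<open>fine_sum_fps = P/((1 + P)(1 - 2P))\<close>, the defining formula simplifies to
  \<open>P/(1 + P)\<close>.\<close>

lemma T_fps_eq: "T_fps * (1 + P_fps) = P_fps"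
proof -
  \<comment> \<open>The \<open>+ 1\<close> cancels the constant term of
    \<open>central_fps 0\<close>, as \<open>fine 0 = 0\<close>.\<close>
  have T: "T_fps = 3 * fine_sum_fps - central_fps 0 + 1"
  proof (rule fps_ext)
    fix n
    show "fps_nth T_fps n = fps_nth (3 * fine_sum_fps - central_fps 0 + 1) n"
      by (cases n) (simp_all add: T_fps_def fine_def fine_sum_fps_def central_fps_def
          numeral_fps_const)
  qed
  have X: "fps_X = P_fps - P_fps\<^sup>2"
    using P_fps_quadratic by simp
  \<comment> \<open>The factor \<open>(1 - P)(1 - 2P)\<close> clears denominators; each bracketed
    difference on the right is a known relation.\<close>
  have "(1 - P_fps) * (1 - 2 * P_fps) * (T_fps * (1 + P_fps))
        - (1 - P_fps) * (1 - 2 * P_fps) * P_fps =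
      3 * (1 - 2 * P_fps) * (fine_sum_fps * (1 - P_fps\<^sup>2) - (P_fps - P_fps\<^sup>2) * central_fps 0)
      + (3 * (P_fps - P_fps\<^sup>2) - (1 - P_fps\<^sup>2)) * ((1 - 2 * P_fps) * central_fps 0 - 1)"
    unfolding T by (simp add: algebra_simps power2_eq_square)
  also have "\<dots> = 0"
    unfolding fine_sum_fps_mult central_fps_0_mult X by simp
  finally have "(1 - P_fps) * (1 - 2 * P_fps) * (T_fps * (1 + P_fps))
      = (1 - P_fps) * (1 - 2 * P_fps) * P_fps"
    by simp
  moreover have "fps_nth ((1 - P_fps) * (1 - 2 * P_fps)) 0 \<noteq> 0"
    by (simp add: P_fps_def)
  then have "(1 - P_fps) * (1 - 2 * P_fps) \<noteq> 0" by fastforce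
  ultimately show ?thesis by (simp only: mult_cancel_left) simp
qed

section \<open>Dyck paths by number of returns\<close>

fun walk :: "int \<Rightarrow> int list \<Rightarrow> bool" where
  "walk h [] \<longleftrightarrow> h = 0"
| "walk h (s # w) \<longleftrightarrow> s \<in> {1, - 1} \<and> 0 \<le> h + s \<and> walk (h + s) w"

fun walk_returns :: "int \<Rightarrow> int list \<Rightarrow> nat" where
  "walk_returns h [] = 0"
| "walk_returns h (s # w) = of_bool (s = - 1 \<and> h + s = 0) + walk_returns (h + s) w"

text \<open>\<open>walk\<close> tests heights only after a step, whereas the prefix condition
  includes \<open>k = 0\<close>; \<open>0 \<le> h\<close> bridges the two.\<close>

lemma walk_iff:
  "0 \<le> h \<Longrightarrow> walk h w \<longleftrightarrow> set w \<subseteq> {1, - 1} \<and>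
     (\<forall>k\<le>length w. 0 \<le> h + sum_list (take k w)) \<and> h + sum_list w = 0"
proof (induction w arbitrary: h)
  case (Cons s w)
  have split: "(\<forall>k\<le>Suc n. Q k) \<longleftrightarrow> Q 0 \<and> (\<forall>k\<le>n. Q (Suc k))" for n Q
    by (metis Suc_le_mono le0 not0_implies_Suc)
  have "walk h (s # w) \<longleftrightarrow> s \<in> {1, - 1} \<and> 0 \<le> h + s \<and> set w \<subseteq> {1, - 1} \<and>
      (\<forall>k\<le>length w. 0 \<le> h + s + sum_list (take k w)) \<and> h + s + sum_list w = 0"
    using Cons.IH[of "h + s"] by auto
  moreover have "0 \<le> h + s" if "\<forall>k\<le>length w. 0 \<le> h + s + sum_list (take k w)"
    using that[rule_format, of 0] by simp
  ultimately show ?case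
    using Cons.prems by (auto simp: split add.assoc)
qed simp

lemma walk_returns_eq:
  "walk_returns h w = card {k. k < length w \<and> w ! k = - 1 \<and> h + sum_list (take (Suc k) w) = 0}"
proof (induction w arbitrary: h)
  case (Cons s w)
  let ?K = "{k. k < length w \<and> w ! k = - 1 \<and> h + s + sum_list (take (Suc k) w) = 0}"
  have "{k. k < length (s # w) \<and> (s # w) ! k = - 1 \<and> h + sum_list (take (Suc k) (s # w)) = 0} =
      {k. k = 0 \<and> s = - 1 \<and> h + s = 0} \<union> Suc ` ?K" (is "?L = ?R")
  proof (rule Set.set_eqI)
    fix k
    show "k \<in> ?L \<longleftrightarrow> k \<in> ?R"
      by (cases k) (auto simp: add.assoc)
  qed
  moreover have "card \<dots> = card {k :: nat. k = 0 \<and> s = - 1 \<and> h + s = 0} + card ?K"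
    by (subst card_Un_disjoint) (auto simp: card_image)
  moreover have "card {k :: nat. k = 0 \<and> s = - 1 \<and> h + s = 0} = of_bool (s = - 1 \<and> h + s = 0)"
    by (cases "s = - 1 \<and> h + s = 0") auto
  ultimately show ?case
    using Cons.IH[of "h + s"] by simp
qed simp

definition walks :: "nat \<Rightarrow> nat \<Rightarrow> nat \<Rightarrow> int list set" where
  "walks h l j = {w. length w = l \<and> walk (int h) w \<and> walk_returns (int h) w = j}"

lemma dyck_returns_eq: "dyck_returns m j = card (walks 0 (2 * m) j)"
  unfolding dyck_returns_def walks_def dyck_paths_def
  by (intro arg_cong[where f = card]) (auto simp: walk_iff walk_returns_eq returns_def)

lemma finite_walks: "finite (walks h l j)"
proof (rule finite_subset)
  show "walks h l j \<subseteq> {w. set w \<subseteq> {1, - 1} \<and> length w = l}"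
    by (auto simp: walks_def walk_iff)
  show "finite {w :: int list. set w \<subseteq> {1, - 1} \<and> length w = l}"
    by (rule finite_lists_length_eq) simp
qed

section \<open>First-step recurrences for walk counts\<close>

lemma card_walks_0: "card (walks h 0 j) = of_bool (h = 0 \<and> j = 0)"
proof -
  have "walks h 0 j = (if h = 0 \<and> j = 0 then {[]} else {})"
    by (auto simp: walks_def)
  then show ?thesis by simp
qed

lemma card_walks_ground: "card (walks 0 (Suc l) j) = card (walks 1 l j)"
proof -
  have "walks 0 (Suc l) j = Cons 1 ` walks 1 l j"
    by (auto simp: walks_def length_Suc_conv)
  then show ?thesis by (simp add: card_image)
qed

text \<open>The set \<open>S\<close> of continuations after a down step is left open, because that
  step is a return exactly from height 1.\<close>

lemma card_walks_Suc:
  assumes "\<And>w. - 1 # w \<in> walks (Suc h) (Suc l) j \<longleftrightarrow> w \<in> S" and "finite S"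
  shows "card (walks (Suc h) (Suc l) j) = card (walks (Suc (Suc h)) l j) + card S"
proof -
  have "w \<in> walks (Suc h) (Suc l) j \<longleftrightarrow>
      w \<in> Cons 1 ` walks (Suc (Suc h)) l j \<union> Cons (- 1) ` S" for w
  proof (cases w)
    case (Cons s v)
    then show ?thesis
      using assms(1)[of v] by (auto simp: walks_def image_iff add.commute)
  qed (auto simp: walks_def)
  then have "walks (Suc h) (Suc l) j = Cons 1 ` walks (Suc (Suc h)) l j \<union> Cons (- 1) ` S"
    by blast
  moreover have "card \<dots> = card (walks (Suc (Suc h)) l j) + card S"
    by (subst card_Un_disjoint) (auto simp: card_image finite_walks assms(2))
  ultimately show ?thesis by simp
qed

lemma card_walks_1:
  "card (walks (Suc 0) (Suc l) j) =
     card (walks (Suc (Suc 0)) l j) + (case j of 0 \<Rightarrow> 0 | Suc i \<Rightarrow> card (walks 0 l i))"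
proof -
  let ?S = "case j of 0 \<Rightarrow> {} | Suc i \<Rightarrow> walks 0 l i"
  have "- 1 # w \<in> walks (Suc 0) (Suc l) j \<longleftrightarrow> w \<in> ?S" for w
    by (cases j) (auto simp: walks_def)
  moreover have "finite ?S"
    by (cases j) (auto simp: finite_walks)
  ultimately show ?thesis
    by (subst card_walks_Suc[of 0 l j ?S]) (auto split: nat.split)
qed

lemma card_walks_high:
  "card (walks (Suc (Suc h)) (Suc l) j) =
     card (walks (Suc (Suc (Suc h))) l j) + card (walks (Suc h) l j)"
proof (rule card_walks_Suc[OF _ finite_walks])
  show "- 1 # w \<in> walks (Suc (Suc h)) (Suc l) j \<longleftrightarrow> w \<in> walks (Suc h) l j" for w
    by (auto simp: walks_def)
qed

text \<open>
  A walk from height \<open>h > 0\<close> first descends to the axis, one factor \<^term>\<open>C_fps\<close> for each level;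
  this descent supplies the first of the \<open>j\<close> returns.
\<close>

definition walk_fps :: "nat \<Rightarrow> nat \<Rightarrow> int fps" where
  "walk_fps h j = (if h = 0 then P_fps ^ j else if j = 0 then 0 else C_fps ^ h * P_fps ^ (j - 1))"

text \<open>\<open>C = 1 + x C^2\<close> mirrors the choice of the first step: the 1 stands for a
  down step and \<open>x C^2\<close> for an up step, which \<open>x\<close> marks.\<close>

lemma walk_fps_step:
  "walk_fps (Suc (Suc h)) j = walk_fps (Suc h) j + fps_X * walk_fps (Suc (Suc (Suc h))) j"
proof -
  let ?Z = "P_fps ^ (j - 1)"
  have "C_fps ^ Suc (Suc h) * ?Z = C_fps ^ Suc h * (1 + fps_X * C_fps\<^sup>2) * ?Z"
    by (simp add: C_fps_eq[symmetric])
  also have "\<dots> = C_fps ^ Suc h * ?Z + fps_X * (C_fps ^ Suc (Suc (Suc h)) * ?Z)"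
    by (simp add: algebra_simps power2_eq_square)
  finally show ?thesis
    by (simp add: walk_fps_def del: power_Suc)
qed

lemma walk_fps_1: "walk_fps (Suc 0) (Suc i) = P_fps ^ i + fps_X * walk_fps (Suc (Suc 0)) (Suc i)"
proof -
  have "C_fps * P_fps ^ i = (1 + fps_X * C_fps\<^sup>2) * P_fps ^ i"
    using C_fps_eq by simp
  then show ?thesis
    by (simp add: walk_fps_def algebra_simps power2_eq_square)
qed

text \<open>A walk of length \<open>2m + h\<close> from height \<open>h\<close> to the axis has
  \<open>m\<close> up steps, hence the index \<open>m\<close>. Induction on the length removes the
  first step.\<close>

lemma card_walks_fps: "l = 2 * m + h \<Longrightarrow> int (card (walks h l j)) = fps_nth (walk_fps h j) m"
proof (induction l arbitrary: h m j)
  case 0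
  have "fps_nth (P_fps ^ j) 0 = of_bool (j = 0)"
    by (cases j) (simp_all add: P_fps_def)
  with 0 show ?case by (simp add: card_walks_0 walk_fps_def)
next
  case (Suc l)
  note IH = Suc.IH
  \<comment> \<open>An up step lowers \<open>m\<close> by one; for \<open>m = 0\<close> only
    \<open>h - 1\<close> steps remain, too few to descend from \<open>h + 1\<close>.\<close>
  have up: "int (card (walks (Suc h) l j)) = fps_nth (fps_X * walk_fps (Suc h) j) m" for j
  proof (cases m)
    case 0
    with Suc.prems have "length w = l \<Longrightarrow> \<not> walk (int (Suc h)) w" for w
    proof -
      assume "length w = l"
      have "set w \<subseteq> {1, - 1} \<Longrightarrow> - int (length w) \<le> sum_list w" for w :: "int list"
        by (induction w) auto
      then show ?thesis
        using Suc.prems 0 \<open>length w = l\<close> by (fastforce simp: walk_iff)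
    qed
    then have "walks (Suc h) l j = {}"
      by (auto simp: walks_def)
    then show ?thesis by (simp add: 0)
  next
    case (Suc m')
    with \<open>Suc l = 2 * m + h\<close> have l: "l = 2 * m' + Suc h" by simp
    show ?thesis using IH[OF l] \<open>m = Suc m'\<close> by simp
  qed
  consider (ground) "h = 0" | (one) "h = 1" | (high) h' where "h = Suc (Suc h')"
    by (metis One_nat_def not0_implies_Suc)
  then show ?case
  proof cases
    case ground
    have "fps_X * walk_fps (Suc 0) j = (if j = 0 then 0 else P_fps ^ j)"
      by (cases j) (simp_all add: walk_fps_def P_fps_def mult_ac)
    \<comment> \<open>For \<open>j = 0\<close> the series are 0 and \<open>P^0 = 1\<close>, which
      agree away from the constant coefficient.\<close>
    moreover have "m > 0"
      using Suc.prems ground by simp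
    ultimately show ?thesis
      using up[of j] ground by (simp add: card_walks_ground walk_fps_def)
  next
    case one
    then have l: "l = 2 * m + 0" using Suc.prems by simp
    show ?thesis
    proof (cases j)
      case 0
      then show ?thesis using up[of j] one by (simp add: card_walks_1 walk_fps_def)
    next
      case (Suc i)
      then show ?thesis
        using up[of j] IH[OF l] one by (simp add: card_walks_1 walk_fps_1) (simp add: walk_fps_def)
    qed
  next
    case high
    then have l: "l = 2 * m + Suc h'" using Suc.prems by simp
    show ?thesis
      using up[of j] IH[OF l] high by (simp add: card_walks_high walk_fps_step[of h' j])
  qed
qed

lemma P_fps_power_nth_0: "k < j \<Longrightarrow> fps_nth (P_fps ^ j) k = 0"
  by (simp add: P_fps_def power_mult_distrib fps_X_power_mult_nth)

text \<open>The factor \<open>x^j\<close> makes the coefficient index independent of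
  \<open>j\<close>. The added terms have \<open>n + 2 - j < j\<close> and vanish since
  \<open>x^j\<close> divides \<open>P^j\<close>.\<close>

lemma A030238_eq: "int (A030238 n) = (\<Sum>j = 1..n + 2. fps_nth ((fps_X * P_fps) ^ j) (n + 2))"
proof -
  have "int (A030238 n) = (\<Sum>j = 1..(n + 2) div 2. fps_nth (P_fps ^ j) (n + 2 - j))"
    by (simp add: A030238_def dyck_returns_eq card_walks_fps walk_fps_def)
  also have "\<dots> = (\<Sum>j = 1..n + 2. fps_nth ((fps_X * P_fps) ^ j) (n + 2))"
    by (rule sum.mono_neutral_cong_left)
      (auto simp: power_mult_distrib fps_X_power_mult_nth P_fps_power_nth_0)
  finally show ?thesis .
qed

text \<open>\<open>x Y = xP/(1 - xP)\<close> is the geometric series \<open>\<Sum> (xP)^j\<close>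
  over \<open>j \<ge> 1\<close>.\<close>

lemma A030238_fps:
  assumes "Y * (1 - fps_X * P_fps) = P_fps"
  shows "int (A030238 n) = fps_nth Y (n + 1)"
proof -
  define Q where "Q = fps_X * P_fps"
  define Z where "Z = fps_X * Y"
  have "Z - Q * Z = fps_X * (Y * (1 - fps_X * P_fps))"
    by (simp add: Q_def Z_def algebra_simps)
  then have Z: "Z = Q + Q * Z"
    unfolding assms unfolding Q_def[symmetric] by (simp only: diff_eq_eq)
  have exp: "Z = (\<Sum>j = 1..K. Q ^ j) + Q ^ K * Z" for K
  proof (induction K)
    case (Suc K)
    have "Q ^ K * Z = Q ^ K * (Q + Q * Z)"
      by (subst Z) (rule refl)
    also have "\<dots> = Q ^ Suc K + Q ^ Suc K * Z"
      by (simp add: algebra_simps)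
    finally show ?case
      using Suc by (simp add: add.assoc)
  qed simp
  have "fps_nth (Q ^ (n + 2) * Z) (n + 2) =
      fps_nth (fps_X ^ (n + 2) * (P_fps ^ (n + 2) * Z)) (n + 2)"
    by (simp only: Q_def power_mult_distrib mult.assoc)
  also have "\<dots> = 0"
    by (simp only: fps_X_power_mult_nth) (simp add: Z_def)
  finally have "fps_nth Z (n + 2) = int (A030238 n)"
    by (subst exp[of "n + 2"]) (simp add: A030238_eq Q_def fps_sum_nth del: sum.cl_ivl_Suc)
  then show ?thesis by (simp add: Z_def)
qed

section \<open>The six determinant families\<close>

lemma fps_shift_eq:
  fixes f :: "nat \<Rightarrow> 'a :: comm_ring_1"
  shows "fps_X ^ s * Abs_fps (\<lambda>i. f (i + s)) = Abs_fps f - (\<Sum>i<s. fps_const (f i) * fps_X ^ i)"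
proof (rule fps_ext)
  fix n
  have "fps_nth (\<Sum>i<s. fps_const (f i) * fps_X ^ i) n = (if n < s then f n else 0)"
    by (simp add: fps_sum_nth if_distrib[of "\<lambda>x. _ * x"] cong: if_cong)
  then show "fps_nth (fps_X ^ s * Abs_fps (\<lambda>i. f (i + s))) n =
      fps_nth (Abs_fps f - (\<Sum>i<s. fps_const (f i) * fps_X ^ i)) n"
    by (auto simp: fps_X_power_mult_nth)
qed

lemma fine_values:
  "fine 0 = 0" "fine (Suc 0) = 1" "fine (Suc (Suc 0)) = 0" "fine (Suc (Suc (Suc 0))) = 1"
  by code_simp+

text \<open>\<open>det_fps_eq\<close> times \<open>x^r\<close>: the resulting \<open>x^(r+1)\<close>
  turns the shifted Fine series into \<open>T\<close> minus its initial terms.\<close>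

lemma det_fps_fine:
  assumes "e * e = 1"
  shows "fps_X ^ r * det_fps e fine (Suc r) + fps_const e *
     (T_fps - (\<Sum>i<Suc r. fps_const (fine i) * fps_X ^ i)) * det_fps e fine (Suc r) = fps_X ^ r"
proof -
  let ?D = "det_fps e fine (Suc r)" and ?A = "Abs_fps (\<lambda>i. fine (i + Suc r))"
  have "fps_X ^ r * ?D = fps_X ^ r - fps_const e * (fps_X ^ Suc r * ?A) * ?D"
    by (subst det_fps_eq[OF assms]) (simp add: algebra_simps)
  then show ?thesis
    unfolding fps_shift_eq T_fps_def[symmetric] by simp
qed

lemma fps_X_eq: "fps_X = P_fps - P_fps\<^sup>2"
  using P_fps_quadratic by simp

lemma P_fps_nonzero: "P_fps \<noteq> 0"
proof -
  have "fps_nth P_fps 1 \<noteq> 0" by (simp add: P_fps_def C_fps_def)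
  then show ?thesis by fastforce
qed

section \<open>Determinant series as rational functions of \<open>P\<close>\<close>

lemmas det_fps_fine_simps = lessThan_Suc numeral_eq_Suc fine_values

text \<open>\<open>1/(1 + T) = (1 + P)/(1 + 2P)\<close>, extended by \<open>1 - P\<close> so that
  the denominator becomes \<open>1 + x - P^2\<close>, the shape of the recurrence for
  \<open>u\<close>.\<close>

lemma det_fps_plus_1:
  "det_fps 1 fine 1 * (1 + fps_X - P_fps\<^sup>2) = 1 - P_fps\<^sup>2"
proof -
  let ?E = "det_fps 1 fine 1"
  have 1: "?E + T_fps * ?E = 1"
    using det_fps_fine[of 1 0] by (simp add: fine_values)
  \<comment> \<open>As in the five lemmas that follow, the difference of the sides, up to a nonzero
    factor, is a combination of the relation \<open>1\<close> and \<open>T_fps_eq\<close>.\<close>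
  have "?E * (1 + fps_X - P_fps\<^sup>2) - (1 - P_fps\<^sup>2) =
      (1 - P_fps) * ((1 + P_fps) * (?E + T_fps * ?E - 1) - ?E * (T_fps * (1 + P_fps) - P_fps))"
    unfolding fps_X_eq by (simp add: algebra_simps power2_eq_square)
  also have "\<dots> = 0" unfolding 1 T_fps_eq by simp
  finally show ?thesis by simp
qed

lemma det_fps_minus_1: "det_fps (- 1) fine 1 = 1 + P_fps"
proof -
  let ?D = "det_fps (- 1) fine 1"
  have 1: "?D - T_fps * ?D = 1"
    using det_fps_fine[of "- 1" 0] by (simp add: fine_values flip: fps_const_neg)
  have "?D - (1 + P_fps) =
      (1 + P_fps) * (?D - T_fps * ?D - 1) + ?D * (T_fps * (1 + P_fps) - P_fps)"
    by (simp add: algebra_simps)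
  also have "\<dots> = 0" unfolding 1 T_fps_eq by simp
  finally show ?thesis by simp
qed

lemma det_fps_plus_2: "det_fps 1 fine 2 = 1 + fps_X - P_fps"
proof -
  let ?E = "det_fps 1 fine 2"
  have 1: "T_fps * ?E = fps_X"
    using det_fps_fine[of 1 1] by (simp add: det_fps_fine_simps algebra_simps)
  have "P_fps * (?E - (1 + fps_X - P_fps)) =
      (1 + P_fps) * (T_fps * ?E - fps_X) - ?E * (T_fps * (1 + P_fps) - P_fps)"
    unfolding fps_X_eq by (simp add: algebra_simps power2_eq_square)
  also have "\<dots> = 0" unfolding 1 T_fps_eq by simp
  finally show ?thesis using P_fps_nonzero by simp
qed

text \<open>\<open>D - 1 = P^2/(1 - 2P^2)\<close>, extended by \<open>(1 - P)^2\<close> to fit the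
  recurrence of \<open>A137398\<close>.\<close>

lemma det_fps_minus_2:
  "(det_fps (- 1) fine 2 - 1) * (1 - 2 * fps_X - 2 * fps_X\<^sup>2 - P_fps\<^sup>2) = fps_X\<^sup>2"
proof -
  let ?D = "det_fps (- 1) fine 2"
  have 1: "?D * (2 * fps_X - T_fps) = fps_X"
    using det_fps_fine[of "- 1" 1]
    by (simp add: det_fps_fine_simps algebra_simps flip: fps_const_neg)
  have "P_fps * ((?D - 1) * (1 - 2 * fps_X - 2 * fps_X\<^sup>2 - P_fps\<^sup>2) - fps_X\<^sup>2) =
      (1 - P_fps)\<^sup>2 * ((1 + P_fps) * (?D * (2 * fps_X - T_fps) - fps_X)
        + ?D * (T_fps * (1 + P_fps) - P_fps))"
    unfolding fps_X_eq by (simp add: algebra_simps power2_eq_square)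
  also have "\<dots> = 0" unfolding 1 T_fps_eq by simp
  finally show ?thesis using P_fps_nonzero by simp
qed

lemma det_fps_plus_3: "(1 - det_fps 1 fine 3) * (1 - fps_X * P_fps) = P_fps"
proof -
  let ?E = "det_fps 1 fine 3"
  have 1: "fps_X\<^sup>2 * ?E + (T_fps - fps_X) * ?E = fps_X\<^sup>2"
    using det_fps_fine[of 1 2] by (simp add: det_fps_fine_simps)
  have "P_fps\<^sup>2 * ((1 - ?E) * (1 - fps_X * P_fps) - P_fps) =
      ?E * (T_fps * (1 + P_fps) - P_fps)
      - (1 + P_fps) * (fps_X\<^sup>2 * ?E + (T_fps - fps_X) * ?E - fps_X\<^sup>2)"
    unfolding fps_X_eq by (simp add: algebra_simps power2_eq_square)
  also have "\<dots> = 0" unfolding 1 T_fps_eq by simp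
  finally show ?thesis using P_fps_nonzero by simp
qed

text \<open>\<open>T - x = P^3/(1 + P)\<close> gives \<open>(1 - P)^3 (1 + P)\<close>; in the form
  chosen, only \<open>- P\<close> contributes beyond \<open>x^2\<close>.\<close>

lemma det_fps_plus_4: "det_fps 1 fine 4 = 1 - fps_X - P_fps - fps_X\<^sup>2"
proof -
  let ?E = "det_fps 1 fine 4"
  have 1: "T_fps * ?E - fps_X * ?E = fps_X ^ 3"
    using det_fps_fine[of 1 3] by (simp add: det_fps_fine_simps algebra_simps)
  have "P_fps ^ 3 * (?E - (1 - fps_X - P_fps - fps_X\<^sup>2)) =
      (1 + P_fps) * (T_fps * ?E - fps_X * ?E - fps_X ^ 3) - ?E * (T_fps * (1 + P_fps) - P_fps)"
    unfolding fps_X_eq by (simp add: algebra_simps power2_eq_square power3_eq_cube)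
  also have "\<dots> = 0" unfolding 1 T_fps_eq by simp
  finally show ?thesis using P_fps_nonzero by simp
qed

section \<open>Extraction of coefficients\<close>

lemma D_plus_fine: "D_plus (map fine [s..<n + s]) = (- 1) ^ n * fps_nth (det_fps 1 fine s) n"
  by (simp add: D_plus_def det_fps_def)

lemma D_minus_fine: "D_minus (map fine [s..<n + s]) = fps_nth (det_fps (- 1) fine s) n"
  by (simp add: D_minus_def det_fps_def)

lemma P_fps_nth: "n > 0 \<Longrightarrow> fps_nth P_fps n = catalan (n - 1)"
  by (simp add: P_fps_def C_fps_def)

text \<open>\<open>P^2 = P - x = x (C - 1)\<close> drops \<open>C_0\<close>, so the convolution
  starts at index 1.\<close>

lemma P_fps_square_nth: "fps_nth (P_fps\<^sup>2 * f) (Suc m) = (\<Sum>i = 1..m. catalan i * fps_nth f (m - i))"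
proof -
  have P: "P_fps\<^sup>2 * f = fps_X * ((C_fps - 1) * f)"
    unfolding P_fps_quadratic by (simp add: P_fps_def algebra_simps)
  have "fps_nth (P_fps\<^sup>2 * f) (Suc m) =
      (\<Sum>i = 0..m. fps_nth (C_fps - 1) i * fps_nth f (m - i))"
    by (simp only: P fps_X_mult_nth)
      (simp add: fps_mult_nth)
  also have "\<dots> = (\<Sum>i = 1..m. catalan i * fps_nth f (m - i))"
    by (intro sum.mono_neutral_cong_right) (auto simp: C_fps_def)
  finally show ?thesis .
qed

lemma det_fps_plus_1_rec:
  assumes "m \<ge> 1"
  defines "E \<equiv> fps_nth (det_fps 1 fine 1)"
  shows "E 0 = 1" "E 1 = - 1" "E (Suc m) = - E m + (\<Sum>i = 1..m - 1. catalan i * E (m - i))"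
proof -
  let ?E = "det_fps 1 fine 1"
  show E0: "E 0 = 1"
    by (simp add: E_def det_fps_def hess_toeplitz_def)
  have eq: "?E = 1 - P_fps\<^sup>2 * 1 - fps_X * ?E + P_fps\<^sup>2 * ?E"
    using det_fps_plus_1 by (simp add: algebra_simps)
  have rec: "E (Suc k) = - (\<Sum>i = 1..k. catalan i * fps_nth 1 (k - i)) - E k
      + (\<Sum>i = 1..k. catalan i * E (k - i))" for k
    unfolding E_def
    by (subst eq) (simp only: fps_sub_nth fps_add_nth P_fps_square_nth fps_X_mult_nth, simp)
  show "E 1 = - 1"
    using rec[of 0] E0 by simp
  \<comment> \<open>Only \<open>i = m\<close> survives in the first sum of \<open>rec\<close>; its
    \<open>- C_m\<close> cancels the last summand \<open>C_m * E 0\<close> of the second.\<close>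
  moreover have "(\<Sum>i = 1..m - 1. catalan i * fps_nth (1 :: int fps) (m - i)) = 0"
    by (intro sum.neutral) auto
  moreover have "{1..m} = insert m {1..m - 1}" using assms(1) by auto
  ultimately show "E (Suc m) = - E m + (\<Sum>i = 1..m - 1. catalan i * E (m - i))"
    using rec[of m] assms(1) E0 by (simp cong: sum.cong_simp)
qed

lemma A137398_initial: "A137398 (Suc 0) = 0" "A137398 2 = 1" "A137398 3 = 2"
  by (subst A137398.simps, simp)+

lemma det_fps_minus_2_nth:
  "n \<ge> 1 \<Longrightarrow> fps_nth (det_fps (- 1) fine 2) n = A137398 n"
proof (induction n rule: less_induct)
  case (less n)
  define B where "B = det_fps (- 1) fine 2 - 1"
  have B: "fps_nth B k = fps_nth (det_fps (- 1) fine 2) k" if "k \<ge> 1" for k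
    using that by (simp add: B_def)
  have eq: "B = fps_X ^ 2 + 2 * (fps_X * B) + 2 * (fps_X * (fps_X * B)) + P_fps\<^sup>2 * B"
    using det_fps_minus_2 unfolding B_def[symmetric]
    by (simp add: algebra_simps power2_eq_square)
  have B0: "fps_nth B 0 = 0"
    by (simp add: B_def det_fps_def hess_toeplitz_def)
  have step: "fps_nth B (Suc m) = fps_nth (fps_X ^ 2) (Suc m) + 2 * fps_nth B m
      + 2 * fps_nth (fps_X * B) m + (\<Sum>i = 1..m. catalan i * fps_nth B (m - i))" for m
    by (subst eq) (simp add: P_fps_square_nth numeral_fps_const)
  have B1: "fps_nth B 1 = 0"
    using step[of 0] B0 by simp
  consider "n = 1" | "n = 2" | "n \<ge> 3" using less.prems by linarith
  then show ?case
  proof cases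
    case 1
    then show ?thesis using B1 B[of 1] by (simp add: A137398_initial)
  next
    case 2
    then show ?thesis using step[of 1] B0 B1 B[of 2]
      by (simp add: A137398_initial flip: numeral_2_eq_2)
  next
    case 3
    then obtain m where m: "n = m + 3"
      by (metis add.commute le_Suc_ex)
    \<comment> \<open>The last two summands contain \<open>B_1\<close> and \<open>B_0\<close>, both
      zero; hence the upper limit \<open>n - 3\<close>.\<close>
    have "{1..m + 2} = {1..m} \<union> {m + 1, m + 2}" by auto
    then have "(\<Sum>i = 1..m + 2. catalan i * fps_nth B (m + 2 - i)) =
        (\<Sum>i = 1..m. catalan i * fps_nth B (m + 2 - i))"
      using B0 B1 by (intro sum.mono_neutral_right) auto
    then have "fps_nth B n = 2 * fps_nth B (n - 1) + 2 * fps_nth B (n - 2)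
        + (\<Sum>i = 1..n - 3. catalan i * fps_nth B (n - i - 1))"
      using step[of "m + 2"] by (simp add: m numeral_eq_Suc)
    also have "\<dots> = 2 * A137398 (n - 1) + 2 * A137398 (n - 2)
        + (\<Sum>i = 1..n - 3. catalan i * A137398 (n - i - 1))"
      using 3 less.IH B by (intro arg_cong2[of _ _ _ _ "(+)"] sum.cong) auto
    also have "\<dots> = A137398 n"
    \<comment> \<open>The initial value at 3 already agrees with the recurrence:
      \<open>2 * 1 + 2 * 0\<close> and an empty sum.\<close>
    proof (cases "n = 3")
      case True
      then show ?thesis
        by (simp add: A137398_initial)
    next
      case False
      then show ?thesis
        using 3 by (simp add: A137398.simps[of n])
    qed
    finally show ?thesis using B less.prems by simp
  qed
qed

theorem theorem5:
  fixes u :: "nat \<Rightarrow> int"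
  assumes "u 1 = 1" and "u 2 = 1"
    and "\<And>n. n \<ge> 3 \<Longrightarrow>
      u n = u (n - 1) + (\<Sum>i = 1..n - 2. (- 1) ^ (i + 1) * catalan i * u (n - i - 1))"
  shows
    "(\<forall>n\<ge>1. D_plus (map fine [1..<n + 1]) = u n) \<and>
     (\<forall>n\<ge>1. D_minus (map fine [1..<n + 1]) = catalan (n - 1)) \<and>
     (\<forall>n\<ge>2. D_plus (map fine [2..<n + 2]) = (- 1) ^ (n - 1) * catalan (n - 1)) \<and>
     (\<forall>n\<ge>1. D_minus (map fine [2..<n + 2]) = A137398 n) \<and>
     (\<forall>n\<ge>1. D_plus (map fine [3..<n + 3]) = (- 1) ^ (n - 1) * int (A030238 (n - 1))) \<and>
     (\<forall>n\<ge>3. D_plus (map fine [4..<n + 4]) = (- 1) ^ (n - 1) * catalan (n - 1))"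
proof (intro conjI allI impI)
  let ?E = "fps_nth (det_fps 1 fine 1)"
  have E: "?E n = (- 1) ^ n * u n" if "n \<ge> 1" for n
    using that
  proof (induction n rule: less_induct)
    case (less n)
    consider "n = 1" | "n = 2" | "n \<ge> 3" using less.prems by linarith
    then show ?case
    proof cases
      case 1
      then show ?thesis using det_fps_plus_1_rec(2)[of 1] assms(1) by simp
    next
      case 2
      then show ?thesis
        using det_fps_plus_1_rec(2,3)[of 1] assms(2) by (simp add: numeral_2_eq_2)
    next
      case 3
      then obtain m where m: "n = Suc m" "m \<ge> 2" by (cases n) auto
      have "?E n = - ?E m + (\<Sum>i = 1..m - 1. catalan i * ?E (m - i))"
        using m det_fps_plus_1_rec(3)[of m] by simp
      also have "\<dots> = - ((- 1) ^ m * u m) +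
          (\<Sum>i = 1..m - 1. (- 1) ^ n * ((- 1) ^ (i + 1) * catalan i * u (m - i)))"
      proof (intro arg_cong2[of _ _ _ _ "(+)"] sum.cong refl)
        show "- ?E m = - ((- 1) ^ m * u m)"
          using less.IH[of m] m by simp
      next
        fix i assume i: "i \<in> {1..m - 1}"
        then have "?E (m - i) = (- 1) ^ (m - i) * u (m - i)"
          using less.IH[of "m - i"] m by auto
        \<comment> \<open>As \<open>n = m + 1\<close>, the exponents \<open>m - i\<close> and
          \<open>n + i + 1\<close> have equal parity.\<close>
        moreover have "(- 1 :: int) ^ (m - i) = (- 1) ^ n * (- 1) ^ (i + 1)"
          using i m by (auto simp: minus_one_power_iff)
        ultimately show "catalan i * ?E (m - i) =
            (- 1) ^ n * ((- 1) ^ (i + 1) * catalan i * u (m - i))"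
          by (simp only: mult_ac)
      qed
      also have "\<dots> = (- 1) ^ n * u n"
        using assms(3)[of n] 3 m(1) by (simp add: sum_distrib_left algebra_simps)
      finally show ?thesis .
    qed
  qed
  show "D_plus (map fine [1..<n + 1]) = u n" if "n \<ge> 1" for n
    unfolding D_plus_fine E[OF that] by (simp add: minus_one_power_iff)
  show "D_minus (map fine [1..<n + 1]) = catalan (n - 1)" if "n \<ge> 1" for n
    unfolding D_minus_fine det_fps_minus_1 using that by (simp add: P_fps_nth)
  \<comment> \<open>From \<open>n = 2\<close> on, the polynomial part \<open>1 + x\<close> no longer
    contributes.\<close>
  show "D_plus (map fine [2..<n + 2]) = (- 1) ^ (n - 1) * catalan (n - 1)" if "n \<ge> 2" for n
    unfolding D_plus_fine det_fps_plus_2 using that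
    by (cases n) (auto simp: P_fps_nth)
  show "D_minus (map fine [2..<n + 2]) = A137398 n" if "n \<ge> 1" for n
    unfolding D_minus_fine by (rule det_fps_minus_2_nth[OF that])
  show "D_plus (map fine [3..<n + 3]) = (- 1) ^ (n - 1) * int (A030238 (n - 1))" if "n \<ge> 1" for n
    unfolding D_plus_fine A030238_fps[OF det_fps_plus_3] using that by (cases n) simp_all
  show "D_plus (map fine [4..<n + 4]) = (- 1) ^ (n - 1) * catalan (n - 1)" if "n \<ge> 3" for n
    unfolding D_plus_fine det_fps_plus_4 using that
    by (cases n) (auto simp: P_fps_nth)
qed

end
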